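(* Let $\mathbb{F}$ be a finite field of characteristic $p$, let $\mathbb{K}:=\mathbb{F}((X))$ be the field of formal Laurent series over $\mathbb{F}$, let $G$ be a $\mathbb{K}$-analytic Lie group, and let $H\subseteq G$ be a compact subgroup such that $H\cong\mathbb{Z}_p$ as a topological group, where $H$ carries the topology induced by $G$ and $\mathbb{Z}_p$ is the additive group of $p$-adic integers with its usual compact topology. Then the group $H$ does not admit a $\mathbb{K}$-analytic Lie group structure compatible with the topology induced by $G$.
   Context: The field $\mathbb{K}=\mathbb{F}((X))$ carries its usual locally compact topology, defined by an absolute value with $0<|X|<1$. $\mathbb{K}$-analytic manifolds and Lie groups are finite-dimensional, modeled on $\mathbb{K}^m$ with $m\in\mathbb{N}_0=\{0,1,2,\ldots\}$, with analytic maps (locally given by convergent power series) as in Serre's "Lie Algebras and Lie Groups". A $\mathbb{K}$-analytic Lie group structure on the group $H$ is a $\mathbb{K}$-analytic manifold structure on the set $H$ making the given group operations of $H$ $\mathbb{K}$-analytic; it is compatible with a given topology on $H$ if the topology underlying the manifold structure is the given one. *)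

theory Defs
  imports
    "HOL-Analysis.Analysis"
    "HOL-Computational_Algebra.Formal_Laurent_Series"
    "HOL-Algebra.Group"
begin

section \<open>Analytic maps over a field of formal Laurent series\<close>

text \<open>
  The field \<open>\<bbbK> = \<F>((X))\<close> is the type \<open>'a fls\<close>. Its library metric is
  \<open>dist a b = \<bar>a - b\<bar>\<close> for the absolute value with \<open>\<bar>X\<bar> = 1/2\<close>, so the type class
  topology is the usual one.
  The dimension \<open>m\<close> is a natural number (possibly \<open>0\<close>) and not a type, since the dimension
  of a manifold structure is quantified inside formulas; \<open>\<bbbK>\<^sup>m\<close> consists of
  the extensional functions on \<open>{..<m}\<close>, with the product topology.
\<close>

definition K_space :: "nat \<Rightarrow> (nat \<Rightarrow> 'a::field fls) topology" where
  "K_space m = product_topology (\<lambda>_. euclidean) {..<m}"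

text \<open>
  The unordered sum is over all multi-indices in \<open>\<nat>\<^sup>m\<close>. The expansion being valid
  on a neighbourhood of \<open>x\<close>, it converges absolutely on a smaller polydisc (evaluate it at
  \<open>x + (X\<^sup>k, \<dots>, X\<^sup>k)\<close> for large \<open>k\<close>), so this is Serre's notion of a convergent power series.
\<close>

definition K_analytic_on ::
  "nat \<Rightarrow> nat \<Rightarrow> (nat \<Rightarrow> 'a::field fls) set \<Rightarrow> ((nat \<Rightarrow> 'a fls) \<Rightarrow> (nat \<Rightarrow> 'a fls)) \<Rightarrow> bool" where
  "K_analytic_on m n U f \<longleftrightarrow>
     openin (K_space m) U \<and> f ` U \<subseteq> topspace (K_space n) \<and>
     (\<forall>x\<in>U. \<exists>V c. openin (K_space m) V \<and> x \<in> V \<and> V \<subseteq> U \<and>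
        (\<forall>y\<in>V. \<forall>j<n.
           ((\<lambda>\<alpha>. c j \<alpha> * (\<Prod>i<m. (y i - x i) ^ \<alpha> i)) has_sum f y j)
             ({..<m} \<rightarrow>\<^sub>E (UNIV :: nat set))))"

section \<open>Analytic manifolds\<close>

type_synonym ('x, 'a) chart = "'x set \<times> ('x \<Rightarrow> nat \<Rightarrow> 'a fls)"

definition is_chart :: "'x topology \<Rightarrow> nat \<Rightarrow> ('x, 'a::field) chart \<Rightarrow> bool" where
  "is_chart T m = (\<lambda>(U, \<phi>).
     openin T U \<and> openin (K_space m) (\<phi> ` U) \<and>
     homeomorphic_map (subtopology T U) (subtopology (K_space m) (\<phi> ` U)) \<phi>)"

text \<open>
  As \<open>c\<close> and \<open>d\<close> range over all ordered pairs of charts, both transition maps of each pair are covered.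
\<close>

definition K_atlas :: "'x topology \<Rightarrow> nat \<Rightarrow> ('x, 'a::field) chart set \<Rightarrow> bool" where
  "K_atlas T m A \<longleftrightarrow>
     (\<forall>c\<in>A. is_chart T m c) \<and>
     (\<Union>c\<in>A. fst c) = topspace T \<and>
     (\<forall>(U, \<phi>)\<in>A. \<forall>(V, \<psi>)\<in>A.
        K_analytic_on m m (\<phi> ` (U \<inter> V)) (\<psi> \<circ> inv_into U \<phi>))"

definition K_analytic_map ::
  "'x topology \<Rightarrow> nat \<Rightarrow> ('x, 'a::field) chart set \<Rightarrow>
   'y topology \<Rightarrow> nat \<Rightarrow> ('y, 'a) chart set \<Rightarrow> ('x \<Rightarrow> 'y) \<Rightarrow> bool" where
  "K_analytic_map S m A T n B f \<longleftrightarrow>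
     continuous_map S T f \<and>
     (\<forall>(U, \<phi>)\<in>A. \<forall>(V, \<psi>)\<in>B.
        K_analytic_on m n (\<phi> ` {x \<in> U. f x \<in> V}) (\<psi> \<circ> f \<circ> inv_into U \<phi>))"

text \<open>
  Charts of a product manifold: \<open>\<phi> \<times> \<psi>\<close> followed by the identification
  \<open>\<bbbK>\<^sup>m \<times> \<bbbK>\<^sup>n = \<bbbK>\<^bsup>m+n\<^esup>\<close>.
\<close>

definition prod_chart ::
  "nat \<Rightarrow> nat \<Rightarrow> ('x, 'a::field) chart \<Rightarrow> ('y, 'a) chart \<Rightarrow> ('x \<times> 'y, 'a) chart" where
  "prod_chart m n c d =
     (fst c \<times> fst d,
      \<lambda>(x, y). \<lambda>i\<in>{..<m + n}. if i < m then snd c x i else snd d y (i - m))"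

definition prod_atlas ::
  "nat \<Rightarrow> nat \<Rightarrow> ('x, 'a::field) chart set \<Rightarrow> ('y, 'a) chart set \<Rightarrow> ('x \<times> 'y, 'a) chart set" where
  "prod_atlas m n A B = {prod_chart m n c d | c d. c \<in> A \<and> d \<in> B}"

section \<open>Analytic Lie groups\<close>

text \<open>
  \<open>K_lie_group G T m A\<close>: the atlas \<open>A\<close> defines a \<open>\<bbbK>\<close>-analytic Lie group structure, modelled on
  \<open>\<bbbK>\<^sup>m\<close> and with underlying topology \<open>T\<close>, on the group \<open>G\<close>. A manifold structure is an
  equivalence class of atlases (equivalently, a maximal atlas) and is represented here
  by any atlas in the class.
\<close>

definition K_lie_group ::
  "('g, 'b) monoid_scheme \<Rightarrow> 'g topology \<Rightarrow> nat \<Rightarrow> ('g, 'a::field) chart set \<Rightarrow> bool" where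
  "K_lie_group G T m A \<longleftrightarrow>
     group G \<and> topspace T = carrier G \<and> K_atlas T m A \<and>
     K_analytic_map (prod_topology T T) (m + m) (prod_atlas m m A A) T m A
       (\<lambda>(x, y). x \<otimes>\<^bsub>G\<^esub> y) \<and>
     K_analytic_map T m A T m A (\<lambda>x. inv\<^bsub>G\<^esub> x)"

section \<open>The topological group of p-adic integers\<close>

text \<open>
  \<open>\<int>\<^sub>p\<close> is the inverse limit of the discrete groups \<open>\<int>/p\<^sup>n\<int>\<close>, each
  represented by \<open>{0..<p\<^sup>n}\<close>.
\<close>

definition padic_int_set :: "nat \<Rightarrow> (nat \<Rightarrow> int) set" where
  "padic_int_set p =
     {x. \<forall>n. x n \<in> {0..<int p ^ n} \<and> x (Suc n) mod int p ^ n = x n}"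

definition padic_int_group :: "nat \<Rightarrow> (nat \<Rightarrow> int) monoid" where
  "padic_int_group p =
     \<lparr>carrier = padic_int_set p,
      mult = (\<lambda>x y n. (x n + y n) mod int p ^ n),
      one = (\<lambda>_. 0)\<rparr>"

definition padic_int_topology :: "nat \<Rightarrow> (nat \<Rightarrow> int) topology" where
  "padic_int_topology p =
     subtopology (product_topology (\<lambda>n. discrete_topology {0..<int p ^ n}) UNIV) (padic_int_set p)"

definition topological_group_isomorphic ::
  "('g, 'b) monoid_scheme \<Rightarrow> 'g topology \<Rightarrow> ('h, 'c) monoid_scheme \<Rightarrow> 'h topology \<Rightarrow> bool" where
  "topological_group_isomorphic G S H T \<longleftrightarrow> (\<exists>f \<in> iso G H. homeomorphic_map S T f)"

end

theory Submission
  imports Defs "HOL-Number_Theory.Cong"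
begin

text \<open>
  In a chart around the unit, multiplication is \<open>u + v\<close> up to second order, so small polydiscs
  of radius \<open>\<bar>X\<bar>\<^sup>k\<close> are open submonoids \<open>V\<^sub>k\<close>. In characteristic \<open>p\<close> the linear part of the \<open>p\<close>-th power map
  vanishes, so this map sends \<open>V\<^sub>k\<close> into \<open>V\<^bsub>k+2\<^esub>\<close> for large \<open>k\<close>. In positive dimension
  the inclusions \<open>V\<^bsub>k+2\<^esub> \<subset> V\<^bsub>k+1\<^esub> \<subset> V\<^sub>k\<close> are strict. But the open submonoids of \<open>\<int>\<^sub>p\<close> are the ideals
  \<open>p\<^sup>a\<int>\<^sub>p\<close>, so \<open>p V\<^sub>k\<close> has only index \<open>p\<close> in \<open>V\<^sub>k\<close>, which leaves no room for the intermediate term.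
  In dimension \<open>0\<close> the group would be discrete.
\<close>

section \<open>First-order approximation of analytic maps\<close>

text \<open>This is the fractional ideal X^k F[[X]], the closed ball of radius |X|^k about 0.
  Working with coefficients avoids a case distinction at 0, whose \<open>fls_subdegree\<close> is 0
  by convention.\<close>

definition fls_ideal :: "int \<Rightarrow> 'a::field fls set" where
  "fls_ideal k = {a. \<forall>n<k. fls_nth a n = 0}"

lemma fls_ideal_zero [simp]: "0 \<in> fls_ideal k"
  by (simp add: fls_ideal_def)

lemma fls_ideal_iff: "a \<in> fls_ideal k \<longleftrightarrow> a = 0 \<or> k \<le> fls_subdegree a"
  by (auto simp: fls_ideal_def intro: fls_subdegree_geI)

lemma fls_ideal_mono: "a \<in> fls_ideal k \<Longrightarrow> l \<le> k \<Longrightarrow> a \<in> fls_ideal l"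
  by (auto simp: fls_ideal_def)

lemma fls_ideal_add: "a \<in> fls_ideal k \<Longrightarrow> b \<in> fls_ideal k \<Longrightarrow> a + b \<in> fls_ideal k"
  by (auto simp: fls_ideal_def)

lemma fls_ideal_diff: "a \<in> fls_ideal k \<Longrightarrow> b \<in> fls_ideal k \<Longrightarrow> a - b \<in> fls_ideal k"
  by (auto simp: fls_ideal_def)

lemma fls_ideal_sum: "(\<And>i. i \<in> I \<Longrightarrow> f i \<in> fls_ideal k) \<Longrightarrow> sum f I \<in> fls_ideal k"
  by (induction I rule: infinite_finite_induct) (auto intro: fls_ideal_add)

lemma fls_ideal_mult: "a \<in> fls_ideal k \<Longrightarrow> b \<in> fls_ideal l \<Longrightarrow> a * b \<in> fls_ideal (k + l)"
  by (cases "a = 0 \<or> b = 0") (auto simp: fls_ideal_iff)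

lemma fls_ideal_power: "a \<in> fls_ideal k \<Longrightarrow> a ^ n \<in> fls_ideal (k * int n)"
proof (induction n)
  case 0
  then show ?case by (simp add: fls_ideal_iff)
next
  case (Suc n)
  then show ?case
    using fls_ideal_mult[of a k "a ^ n" "k * int n"] by (simp add: algebra_simps)
qed

lemma fls_ideal_prod:
  assumes "\<And>i. i \<in> I \<Longrightarrow> f i \<in> fls_ideal (g i)"
  shows "prod f I \<in> fls_ideal (sum g I)"
  using assms
proof (induction I rule: infinite_finite_induct)
  case (insert i I)
  then show ?case by (simp add: fls_ideal_mult)
qed (simp_all add: fls_ideal_iff)

text \<open>Nonzero distances are powers of 2, so a strict bound by \<open>2 powi (1 - k)\<close>
  amounts to a weak bound by \<open>2 powi (- k)\<close>. This is the source of the shift by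
  1.\<close>

lemma dist_fls_less_iff: "dist a b < 2 powi (1 - k) \<longleftrightarrow> a - b \<in> fls_ideal k"
proof (cases "a = b")
  case False
  have "dist a b = 2 powi (- fls_subdegree (a - b))"
    using False by (auto simp: dist_fls_def power_int_def power_one_over inverse_eq_divide)
  also have "\<dots> < 2 powi (1 - k) \<longleftrightarrow> - fls_subdegree (a - b) < 1 - k"
  proof
    assume less: "(2::real) powi (- fls_subdegree (a - b)) < 2 powi (1 - k)"
    show "- fls_subdegree (a - b) < 1 - k"
    proof (rule ccontr)
      assume "\<not> ?thesis"
      then have "(2::real) powi (1 - k) \<le> 2 powi (- fls_subdegree (a - b))"
        by (intro power_int_increasing) auto
      with less show False by simp
    qed
  qed (rule power_int_strict_increasing, auto)
  finally show ?thesis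
    using False by (auto simp: fls_ideal_iff)
qed simp

text \<open>By the ultrametric inequality every point of a ball is a centre of it, so one radius
  serves at all points.\<close>

lemma open_fls_coset: "open {a. a - b \<in> fls_ideal k}"
  unfolding open_dist
proof
  fix a :: "'a fls"
  assume "a \<in> {a. a - b \<in> fls_ideal k}"
  then have a: "a - b \<in> fls_ideal k" by simp
  show "\<exists>e>0. \<forall>y. dist y a < e \<longrightarrow> y \<in> {a. a - b \<in> fls_ideal k}"
  proof (intro exI conjI allI impI)
    fix y assume "dist y a < 2 powi (1 - k)"
    then have "(y - a) + (a - b) \<in> fls_ideal k"
      using a by (intro fls_ideal_add) (auto simp: dist_fls_less_iff)
    then show "y \<in> {a. a - b \<in> fls_ideal k}" by simp
  qed simp
qed

lemma open_fls_contains_coset: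
  assumes "open U" "b \<in> U"
  shows "\<exists>k. \<forall>a. a - b \<in> fls_ideal k \<longrightarrow> a \<in> U"
proof -
  obtain e where e: "e > 0" "\<And>y. dist y b < e \<Longrightarrow> y \<in> U"
    using assms unfolding open_dist by blast
  obtain n where n: "(1/2::real) ^ n < e"
    using real_arch_pow_inv[of e "1/2"] e by auto
  have "2 powi (1 - (int n + 1)) = (1/2::real) ^ n"
    by (simp add: power_int_minus power_one_over inverse_eq_divide)
  then show ?thesis
    using n e(2) by (intro exI[of _ "int n + 1"]) (simp flip: dist_fls_less_iff)
qed

section \<open>Unordered sums in the ultrametric setting\<close>

text \<open>Convergence is recast as congruence of partial sums modulo an ideal; \<open>D\<close>
  lets prescribed indices be forced into \<open>F\<close>.\<close>

lemma has_sum_fls_ideal: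
  assumes "(f has_sum s) A" "finite D"
  shows "\<exists>F. finite F \<and> D \<inter> A \<subseteq> F \<and> F \<subseteq> A \<and> (\<forall>F'. finite F' \<and> F \<subseteq> F' \<and> F' \<subseteq> A \<longrightarrow> sum f F' - s \<in> fls_ideal N)"
proof -
  have "eventually (\<lambda>F. sum f F \<in> {a. a - s \<in> fls_ideal N}) (finite_subsets_at_top A)"
    using assms(1) open_fls_coset[of s N] unfolding has_sum_def
    by (rule topological_tendstoD) auto
  then obtain F where F: "finite F" "F \<subseteq> A"
    "\<And>F'. finite F' \<Longrightarrow> F \<subseteq> F' \<Longrightarrow> F' \<subseteq> A \<Longrightarrow> sum f F' - s \<in> fls_ideal N"
    unfolding eventually_finite_subsets_at_top by auto
  show ?thesis
    by (rule exI[of _ "F \<union> (D \<inter> A)"]) (use F assms(2) in auto)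
qed

text \<open>Outside a large finite set each term is a difference of two partial sums close to
  \<open>s\<close>, and the finitely many other terms have a least order.\<close>

lemma has_sum_terms_bounded:
  assumes "(f has_sum s) A"
  shows "\<exists>N. \<forall>x\<in>A. f x \<in> fls_ideal N"
proof -
  obtain F where F: "finite F" "F \<subseteq> A"
    "\<And>F'. finite F' \<Longrightarrow> F \<subseteq> F' \<Longrightarrow> F' \<subseteq> A \<Longrightarrow> sum f F' - s \<in> fls_ideal 0"
    using has_sum_fls_ideal[OF assms, of "{}" 0] by auto
  \<comment> \<open>Inserting 0 keeps \<open>Min\<close> defined for empty \<open>F\<close> and
    ensures \<open>N \<le> 0\<close>, since terms outside \<open>F\<close> are only known to lie in
    \<open>fls_ideal 0\<close>.\<close>
  define N where "N = Min (insert 0 (fls_subdegree ` f ` F))"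
  have "f x \<in> fls_ideal N" if "x \<in> A" for x
  proof (cases "x \<in> F")
    case True
    then show ?thesis using F(1) by (auto simp: fls_ideal_iff N_def)
  next
    case False
    have "(sum f (insert x F) - s) - (sum f F - s) \<in> fls_ideal 0"
      using F that by (intro fls_ideal_diff F(3)) auto
    then have "f x \<in> fls_ideal 0" using False F(1) by simp
    then show ?thesis
      by (rule fls_ideal_mono) (use F(1) in \<open>simp add: N_def\<close>)
  qed
  then show ?thesis by blast
qed

text \<open>Some partial sum containing \<open>D\<close> is congruent to \<open>s\<close> modulo the
  ideal, and its terms outside \<open>D\<close> lie in the ideal.\<close>

lemma has_sum_diff_finite_fls_ideal:
  assumes "(f has_sum s) A" "finite D" "D \<subseteq> A"
    and "\<And>x. x \<in> A - D \<Longrightarrow> f x \<in> fls_ideal N"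
  shows "s - sum f D \<in> fls_ideal N"
proof -
  obtain F where F: "finite F" "F \<subseteq> A" "D \<subseteq> F" "sum f F - s \<in> fls_ideal N"
    using has_sum_fls_ideal[OF assms(1,2), of N] assms(3) by (metis Int_absorb2 order_refl)
  have "sum f F - sum f D = sum f (F - D)"
    using F by (simp add: sum_diff)
  also have "\<dots> \<in> fls_ideal N"
    using F assms(4) by (intro fls_ideal_sum) auto
  finally have "(sum f F - sum f D) - (sum f F - s) \<in> fls_ideal N"
    using F(4) by (rule fls_ideal_diff)
  then show ?thesis by (simp add: algebra_simps)
qed

section \<open>Polydiscs as a neighbourhood basis\<close>

text \<open>The extensional product makes polydiscs subsets of \<open>K_space m\<close>. The centre
  \<open>x\<close> belongs to its polydisc only if it is itself a point of that space.\<close>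

definition polydisc :: "nat \<Rightarrow> (nat \<Rightarrow> 'a::field fls) \<Rightarrow> int \<Rightarrow> (nat \<Rightarrow> 'a fls) set" where
  "polydisc m x k = (\<Pi>\<^sub>E i\<in>{..<m}. {a. a - x i \<in> fls_ideal k})"

lemma polydisc_iff:
  "y \<in> polydisc m x k \<longleftrightarrow> y \<in> topspace (K_space m) \<and> (\<forall>i<m. y i - x i \<in> fls_ideal k)"
  by (auto simp: polydisc_def K_space_def PiE_iff)

lemma polydisc_mono: "l \<le> k \<Longrightarrow> polydisc m x k \<subseteq> polydisc m x l"
  by (rule subsetI) (simp add: polydisc_iff fls_ideal_mono[of _ k l])

lemma openin_polydisc: "openin (K_space m) (polydisc m x k)"
  unfolding polydisc_def K_space_def by (simp add: openin_PiE open_fls_coset)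

lemma openin_K_space_contains_polydisc:
  assumes "openin (K_space m) U" "x \<in> U"
  shows "\<exists>k. polydisc m x k \<subseteq> U"
proof -
  have "\<exists>W. (\<forall>i\<in>{..<m}. open (W i)) \<and> x \<in> Pi\<^sub>E {..<m} W \<and> Pi\<^sub>E {..<m} W \<subseteq> U"
    using assms unfolding K_space_def openin_product_topology_alt by simp
  then obtain W where "(\<forall>i\<in>{..<m}. open (W i)) \<and> x \<in> Pi\<^sub>E {..<m} W \<and> Pi\<^sub>E {..<m} W \<subseteq> U"
    by (rule exE)
  then have W: "\<And>i. i < m \<Longrightarrow> open (W i)" "x \<in> Pi\<^sub>E {..<m} W" "Pi\<^sub>E {..<m} W \<subseteq> U"
    by simp_all
  have "\<forall>i\<in>{..<m}. \<exists>k. \<forall>a. a - x i \<in> fls_ideal k \<longrightarrow> a \<in> W i"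
    using W by (intro ballI open_fls_contains_coset) auto
  then obtain k where k: "\<And>i a. i < m \<Longrightarrow> a - x i \<in> fls_ideal (k i) \<Longrightarrow> a \<in> W i"
    by (metis lessThan_iff)
  \<comment> \<open>The smallest of finitely many radii; the inserted 0 covers
    \<open>m = 0\<close>.\<close>
  define K where "K = Max (insert 0 (k ` {..<m}))"
  have "polydisc m x K \<subseteq> Pi\<^sub>E {..<m} W"
  proof
    fix y assume "y \<in> polydisc m x K"
    then have y: "y \<in> extensional {..<m}" "\<And>i. i < m \<Longrightarrow> y i - x i \<in> fls_ideal K"
      by (auto simp: polydisc_iff K_space_def PiE_iff)
    have "y i \<in> W i" if "i < m" for i
      by (rule k[OF that], rule fls_ideal_mono[OF y(2)[OF that]])
         (use that in \<open>simp add: K_def\<close>)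
    with y show "y \<in> Pi\<^sub>E {..<m} W" by (simp add: PiE_iff)
  qed
  with W show ?thesis by blast
qed


section \<open>Linear part and quadratic remainder of a power series\<close>

definition unit_index :: "nat \<Rightarrow> nat \<Rightarrow> nat \<Rightarrow> nat" where
  "unit_index m i = (\<lambda>l\<in>{..<m}. if l = i then 1 else 0)"

definition zero_index :: "nat \<Rightarrow> nat \<Rightarrow> nat" where
  "zero_index m = (\<lambda>l\<in>{..<m}. 0)"

lemma degree_at_least_2:
  assumes "\<alpha> \<in> {..<m} \<rightarrow>\<^sub>E (UNIV :: nat set)"
    and "\<alpha> \<notin> insert (zero_index m) (unit_index m ` {..<m})"
  shows "2 \<le> sum \<alpha> {..<m}"
proof (rule ccontr)
  assume "\<not> ?thesis"
  then consider "sum \<alpha> {..<m} = 0" | "sum \<alpha> {..<m} = 1" by linarith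
  then show False
  proof cases
    case 1
    then have "\<alpha> = zero_index m"
      using assms(1) by (auto simp: zero_index_def fun_eq_iff PiE_iff extensional_def)
    with assms(2) show False by simp
  next
    case 2
    then obtain i where i: "i < m" "\<alpha> i = 1" "\<And>l. l < m \<Longrightarrow> l \<noteq> i \<Longrightarrow> \<alpha> l = 0"
      using sum_eq_1_iff[of "{..<m}" \<alpha>] by auto
    then have "\<alpha> = unit_index m i"
      using assms(1) by (auto simp: unit_index_def fun_eq_iff PiE_iff extensional_def)
    with assms(2) i(1) show False by simp
  qed
qed

lemma sum_degree_at_most_1:
  fixes c :: "(nat \<Rightarrow> nat) \<Rightarrow> 'a::field fls"
  shows "(\<Sum>\<alpha>\<in>insert (zero_index m) (unit_index m ` {..<m}). c \<alpha> * (\<Prod>i<m. w i ^ \<alpha> i)) =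
    c (zero_index m) + (\<Sum>i<m. c (unit_index m i) * w i)"
proof -
  have inj: "inj_on (unit_index m) {..<m}"
    by (auto simp: inj_on_def unit_index_def fun_eq_iff split: if_splits)
  have notin: "zero_index m \<notin> unit_index m ` {..<m}"
    by (auto simp: zero_index_def unit_index_def fun_eq_iff) (metis zero_neq_one)
  have "(\<Prod>l<m. w l ^ unit_index m i l) = w i" if "i < m" for i
  proof -
    have "(\<Prod>l<m. w l ^ unit_index m i l) = (\<Prod>l<m. if l = i then w l else 1)"
      by (intro prod.cong) (auto simp: unit_index_def)
    with that show ?thesis by simp
  qed
  moreover have "(\<Prod>l<m. w l ^ zero_index m l) = 1"
    by (simp add: zero_index_def)
  ultimately show ?thesis
    using notin by (simp add: sum.reindex[OF inj])
qed

text \<open>Convergence at one point of radius |X|^r places \<open>c \<alpha>\<close> in the ideal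
  of exponent \<open>M - r * d\<close>, where \<open>d\<close> is the degree of
  \<open>\<alpha>\<close>. For \<open>k \<ge> r\<close> a term of degree \<open>d \<ge> 2\<close>
  then has exponent at least \<open>M + (k - r) * d\<close>, hence at least
  \<open>2 * k - (2 * r - M)\<close>. The loss \<open>N = 2 * r - M\<close> is the same for all
  \<open>k\<close>.\<close>

lemma power_series_linear_approximation:
  fixes c :: "(nat \<Rightarrow> nat) \<Rightarrow> 'a::field fls"
  assumes sums: "\<And>y. y \<in> polydisc m x r \<Longrightarrow>
      ((\<lambda>\<alpha>. c \<alpha> * (\<Prod>i<m. (y i - x i) ^ \<alpha> i)) has_sum g y) ({..<m} \<rightarrow>\<^sub>E (UNIV :: nat set))"
    and x: "x \<in> topspace (K_space m)"
  shows "\<exists>N. \<forall>k\<ge>r. \<forall>y\<in>polydisc m x k.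
      g y - g x - (\<Sum>i<m. c (unit_index m i) * (y i - x i)) \<in> fls_ideal (2 * k - N)"
proof -
  let ?I = "{..<m} \<rightarrow>\<^sub>E (UNIV :: nat set)"
  let ?X = "fls_X_intpow :: int \<Rightarrow> 'a fls"
  let ?D = "insert (zero_index m) (unit_index m ` {..<m})"
  have X: "?X k \<in> fls_ideal k" for k
    by (auto simp: fls_ideal_def)
  \<comment> \<open>At this point every monomial is an exact power of X, so bounds on the terms
    become bounds on the coefficients.\<close>
  define y0 where "y0 = (\<lambda>i\<in>{..<m}. x i + ?X r)"
  have "y0 \<in> polydisc m x r"
    using X by (auto simp: polydisc_iff y0_def K_space_def)
  from has_sum_terms_bounded[OF sums[OF this]] obtain M
    where M: "\<And>\<alpha>. \<alpha> \<in> ?I \<Longrightarrow> c \<alpha> * (\<Prod>i<m. (y0 i - x i) ^ \<alpha> i) \<in> fls_ideal M" by blast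
  have coeff: "c \<alpha> \<in> fls_ideal (M - r * int (sum \<alpha> {..<m}))" if "\<alpha> \<in> ?I" for \<alpha>
  proof -
    let ?s = "r * int (sum \<alpha> {..<m})"
    have "(\<Prod>i<m. (y0 i - x i) ^ \<alpha> i) = (\<Prod>i<m. ?X r ^ \<alpha> i)"
      by (intro prod.cong) (auto simp: y0_def)
    also have "\<dots> = ?X r ^ sum \<alpha> {..<m}"
      by (simp add: power_sum)
    also have "\<dots> = ?X ?s"
      by (simp add: fls_X_intpow_power mult.commute)
    finally have "c \<alpha> * ?X ?s \<in> fls_ideal M"
      using M[OF that] by simp
    from fls_ideal_mult[OF this X[of "- ?s"]]
    have "c \<alpha> * (?X ?s * ?X (- ?s)) \<in> fls_ideal (M - ?s)"
      by (simp only: mult.assoc) simp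
    moreover have "?X ?s * ?X (- ?s) = 1"
      by (simp only: fls_X_intpow_times_fls_X_intpow) simp
    ultimately show ?thesis by simp
  qed
  have high: "c \<alpha> * (\<Prod>i<m. (y i - x i) ^ \<alpha> i) \<in> fls_ideal (2 * k - (2 * r - M))"
    if k: "r \<le> k" and y: "y \<in> polydisc m x k" and \<alpha>: "\<alpha> \<in> ?I - ?D" for k y \<alpha>
  proof -
    let ?d = "int (sum \<alpha> {..<m})"
    have "(\<Prod>i<m. (y i - x i) ^ \<alpha> i) \<in> fls_ideal (\<Sum>i<m. k * int (\<alpha> i))"
      using y by (intro fls_ideal_prod fls_ideal_power) (auto simp: polydisc_iff)
    then have "(\<Prod>i<m. (y i - x i) ^ \<alpha> i) \<in> fls_ideal (k * ?d)"
      by (simp add: sum_distrib_left)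
    then have "c \<alpha> * (\<Prod>i<m. (y i - x i) ^ \<alpha> i) \<in> fls_ideal (M - r * ?d + k * ?d)"
      using coeff[of \<alpha>] \<alpha> by (intro fls_ideal_mult) auto
    \<comment> \<open>Degree at least 2 produces the factor 2 in front of \<open>k\<close>.\<close>
    moreover have "(k - r) * 2 \<le> (k - r) * ?d"
      using degree_at_least_2[of \<alpha> m] \<alpha> k by (intro mult_left_mono) (auto simp del: of_nat_sum)
    ultimately show ?thesis
      by (elim fls_ideal_mono) (simp add: algebra_simps)
  qed
  have approx: "g y - (c (zero_index m) + (\<Sum>i<m. c (unit_index m i) * (y i - x i)))
      \<in> fls_ideal (2 * k - (2 * r - M))"
    if k: "r \<le> k" and y: "y \<in> polydisc m x k" for k y
  proof -
    have "y \<in> polydisc m x r" using polydisc_mono[OF k] y by blast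
    moreover have "finite ?D" "?D \<subseteq> ?I"
      by (auto simp: zero_index_def unit_index_def split: if_splits)
    ultimately have "g y - (\<Sum>\<alpha>\<in>?D. c \<alpha> * (\<Prod>i<m. (y i - x i) ^ \<alpha> i)) \<in> fls_ideal (2 * k - (2 * r - M))"
      by (rule has_sum_diff_finite_fls_ideal[OF sums]) (rule high[OF k y])
    then show ?thesis by (simp only: sum_degree_at_most_1)
  qed
  have "g y - g x - (\<Sum>i<m. c (unit_index m i) * (y i - x i)) \<in> fls_ideal (2 * k - (2 * r - M))"
    if k: "r \<le> k" and y: "y \<in> polydisc m x k" for k y
  proof -
    \<comment> \<open>The approximation at \<open>y = x\<close> compares \<open>g x\<close> with the
      constant term, which cancels in the difference.\<close>
    have "x \<in> polydisc m x k" using x by (simp add: polydisc_iff)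
    from fls_ideal_diff[OF approx[OF k y] approx[OF k this]]
    show ?thesis by (simp add: algebra_simps)
  qed
  then show ?thesis by blast
qed

lemma K_analytic_on_linear_approximation:
  fixes f :: "(nat \<Rightarrow> 'a::field fls) \<Rightarrow> nat \<Rightarrow> 'a fls"
  assumes "K_analytic_on m n U f" "x \<in> U"
  shows "\<exists>r N L. polydisc m x r \<subseteq> U \<and> (\<forall>k\<ge>r. \<forall>y\<in>polydisc m x k. \<forall>j<n.
      f y j - f x j - (\<Sum>i<m. L j i * (y i - x i)) \<in> fls_ideal (2 * k - N))"
proof -
  have "\<exists>V c. openin (K_space m) V \<and> x \<in> V \<and> V \<subseteq> U \<and> (\<forall>y\<in>V. \<forall>j<n.
      ((\<lambda>\<alpha>. c j \<alpha> * (\<Prod>i<m. (y i - x i) ^ \<alpha> i)) has_sum f y j) ({..<m} \<rightarrow>\<^sub>E (UNIV :: nat set)))"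
    using assms unfolding K_analytic_on_def by simp
  then obtain V c where V: "openin (K_space m) V" "x \<in> V" "V \<subseteq> U"
    and c: "\<And>y j. y \<in> V \<Longrightarrow> j < n \<Longrightarrow>
      ((\<lambda>\<alpha>. c j \<alpha> * (\<Prod>i<m. (y i - x i) ^ \<alpha> i)) has_sum f y j) ({..<m} \<rightarrow>\<^sub>E (UNIV :: nat set))"
    by blast
  obtain r where r: "polydisc m x r \<subseteq> V"
    using openin_K_space_contains_polydisc[OF V(1,2)] by blast
  have x: "x \<in> topspace (K_space m)"
    using openin_subset[OF V(1)] V(2) by blast
  have "\<forall>j<n. \<exists>N. \<forall>k\<ge>r. \<forall>y\<in>polydisc m x k.
      f y j - f x j - (\<Sum>i<m. c j (unit_index m i) * (y i - x i)) \<in> fls_ideal (2 * k - N)"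
    using r c by (intro allI impI power_series_linear_approximation x) auto
  then have "\<exists>M. \<forall>j<n. \<forall>k\<ge>r. \<forall>y\<in>polydisc m x k.
      f y j - f x j - (\<Sum>i<m. c j (unit_index m i) * (y i - x i)) \<in> fls_ideal (2 * k - M j)"
    by (rule choice_iff'[THEN iffD1])
  then obtain M where M: "\<And>j k y. j < n \<Longrightarrow> r \<le> k \<Longrightarrow> y \<in> polydisc m x k \<Longrightarrow>
      f y j - f x j - (\<Sum>i<m. c j (unit_index m i) * (y i - x i)) \<in> fls_ideal (2 * k - M j)"
    by blast
  \<comment> \<open>The sum of absolute values is a common loss for all components, and makes sense
    for \<open>n = 0\<close> too.\<close>
  have bound: "M j \<le> (\<Sum>j<n. \<bar>M j\<bar>)" if "j < n" for j
    using member_le_sum[of j "{..<n}" "\<lambda>j. \<bar>M j\<bar>"] that by auto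
  have "f y j - f x j - (\<Sum>i<m. c j (unit_index m i) * (y i - x i))
      \<in> fls_ideal (2 * k - (\<Sum>j<n. \<bar>M j\<bar>))"
    if "j < n" "r \<le> k" "y \<in> polydisc m x k" for j k y
    by (rule fls_ideal_mono[OF M[OF that]]) (use bound[OF that(1)] in simp)
  then show ?thesis
    using r V(3) by (intro exI[of _ r] exI[of _ "\<Sum>j<n. \<bar>M j\<bar>"]
      exI[of _ "\<lambda>j i. c j (unit_index m i)"]) auto
qed

section \<open>Open submonoids of the p-adic integers\<close>

text \<open>This is p^n Z_p, described as the kernel of the projection to Z/p^n.\<close>

definition padic_ideal :: "nat \<Rightarrow> nat \<Rightarrow> (nat \<Rightarrow> int) set" where
  "padic_ideal p n = {x \<in> padic_int_set p. x n = 0}"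

lemma padic_int_mod:
  assumes "x \<in> padic_int_set p" "i \<le> j"
  shows "x j mod int p ^ i = x i"
  using assms(2)
proof (induction j rule: dec_induct)
  case base
  have "x i \<in> {0..<int p ^ i}" using assms(1) by (auto simp: padic_int_set_def)
  then show ?case by simp
next
  case (step j)
  have "int p ^ i dvd int p ^ j" using step by (simp add: le_imp_power_dvd)
  then have "x (Suc j) mod int p ^ i = x (Suc j) mod int p ^ j mod int p ^ i"
    by (simp add: mod_mod_cancel)
  also have "\<dots> = x i" using assms(1) step by (simp add: padic_int_set_def)
  finally show ?case .
qed

lemma padic_ideal_antimono:
  assumes "i \<le> j"
  shows "padic_ideal p j \<subseteq> padic_ideal p i"
  using padic_int_mod[OF _ assms] by (fastforce simp: padic_ideal_def)

definition padic_of_nat :: "nat \<Rightarrow> nat \<Rightarrow> nat \<Rightarrow> int" where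
  "padic_of_nat p a = (\<lambda>n. int a mod int p ^ n)"

lemma padic_of_nat_in: "p > 0 \<Longrightarrow> padic_of_nat p a \<in> padic_int_set p"
  by (auto simp: padic_of_nat_def padic_int_set_def mod_mod_cancel)

lemma padic_of_prime_power_in_ideal_iff:
  assumes "p > 1"
  shows "padic_of_nat p (p ^ n) \<in> padic_ideal p k \<longleftrightarrow> k \<le> n"
proof -
  have "padic_of_nat p (p ^ n) \<in> padic_ideal p k \<longleftrightarrow> int p ^ k dvd int p ^ n"
    using assms padic_of_nat_in[of p "p ^ n"]
    by (auto simp: padic_ideal_def padic_of_nat_def dvd_eq_mod_eq_0)
  also have "\<dots> \<longleftrightarrow> k \<le> n"
    using assms by (auto simp: le_imp_power_dvd simp flip: of_nat_power dest: power_dvd_imp_le)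
  finally show ?thesis .
qed

lemma padic_ideal_subset_imp_le:
  assumes "p > 1" "padic_ideal p j \<subseteq> padic_ideal p i"
  shows "i \<le> j"
  using assms padic_of_prime_power_in_ideal_iff[of p j] by blast

text \<open>The group is additive, so the power \<open>[^]\<close> is the multiple by
  \<open>a\<close>.\<close>

lemma padic_pow_nth:
  assumes "x \<in> padic_int_set p"
  shows "(x [^]\<^bsub>padic_int_group p\<^esub> (a::nat)) n = int a * x n mod int p ^ n"
proof (induction a)
  case 0
  then show ?case by (simp add: nat_pow_def padic_int_group_def)
next
  case (Suc a)
  have "(x [^]\<^bsub>padic_int_group p\<^esub> (Suc a)) n = (int a * x n mod int p ^ n + x n) mod int p ^ n"
    using Suc by (simp add: nat_pow_def padic_int_group_def)
  also have "\<dots> = int (Suc a) * x n mod int p ^ n"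
    by (simp add: mod_add_left_eq mod_add_right_eq algebra_simps)
  finally show ?case .
qed

text \<open>A basic open set restricts finitely many coordinates, and an element vanishing at level
  \<open>N\<close> vanishes at all lower levels.\<close>

lemma openin_padic_contains_ideal:
  assumes "openin (padic_int_topology p) S" "(\<lambda>_. 0) \<in> S"
  shows "\<exists>N. padic_ideal p N \<subseteq> S"
proof -
  obtain W where W: "openin (product_topology (\<lambda>n. discrete_topology {0..<int p ^ n}) UNIV) W"
    and S: "S = W \<inter> padic_int_set p"
    using assms(1) by (auto simp: padic_int_topology_def openin_subtopology)
  obtain U where U: "finite {i. U i \<noteq> {0..<int p ^ i}}" "(\<lambda>_. 0) \<in> Pi\<^sub>E UNIV U" "Pi\<^sub>E UNIV U \<subseteq> W"
    using W assms(2) S unfolding openin_product_topology_alt by auto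
  obtain N where N: "\<And>i. U i \<noteq> {0..<int p ^ i} \<Longrightarrow> i \<le> N"
    using U(1) finite_nat_set_iff_bounded_le by auto
  have "x i \<in> U i" if x: "x \<in> padic_ideal p N" for x i
  proof (cases "i \<le> N")
    case True
    then have "x i = 0" using padic_ideal_antimono[OF True] x by (auto simp: padic_ideal_def)
    with U(2) show ?thesis by (simp add: PiE_iff)
  next
    case False
    then have "U i = {0..<int p ^ i}" using N by blast
    then show ?thesis using x by (simp add: padic_ideal_def padic_int_set_def)
  qed
  with U(3) S have "padic_ideal p N \<subseteq> S" by (auto simp: padic_ideal_def)
  then show ?thesis by blast
qed

text \<open>The natural multiples of an element are already dense in the closed subgroup it generates.\<close>
lemma open_padic_submonoid:
  assumes p: "prime p" and S: "openin (padic_int_topology p) S" "(\<lambda>_. 0) \<in> S"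
    and closed: "\<And>x y. x \<in> S \<Longrightarrow> y \<in> S \<Longrightarrow> x \<otimes>\<^bsub>padic_int_group p\<^esub> y \<in> S"
  shows "\<exists>n. S = padic_ideal p n"
proof -
  have p1: "p > 1" using p by (rule prime_gt_1_nat)
  have sub: "S \<subseteq> padic_int_set p"
    using openin_subset[OF S(1)] by (auto simp: padic_int_topology_def)
  obtain N where N: "padic_ideal p N \<subseteq> S"
    using openin_padic_contains_ideal[OF S] by blast
  \<comment> \<open>The maximum exists because \<open>S\<close> contains p^N Z_p. Maximality yields
    an element \<open>x\<close> of \<open>S\<close> with valuation exactly \<open>n\<close>.\<close>
  define n where "n = (GREATEST n. S \<subseteq> padic_ideal p n)"
  have bd: "n \<le> N" if "S \<subseteq> padic_ideal p n" for n
    using padic_ideal_subset_imp_le[OF p1] N that by blast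
  have "S \<subseteq> padic_ideal p 0"
    using sub by (fastforce simp: padic_ideal_def padic_int_set_def dest: spec[of _ 0])
  then have n: "S \<subseteq> padic_ideal p n"
    unfolding n_def using bd by (rule GreatestI_nat)
  have "\<not> S \<subseteq> padic_ideal p (Suc n)"
    using Greatest_le_nat[of "\<lambda>n. S \<subseteq> padic_ideal p n" "Suc n" N] bd unfolding n_def by auto
  then obtain x where x: "x \<in> S" "x \<notin> padic_ideal p (Suc n)" by blast
  have xp: "x \<in> padic_int_set p" using x sub by blast
  have pow: "x [^]\<^bsub>padic_int_group p\<^esub> (a::nat) \<in> S" for a
    by (induction a) (use x S closed in \<open>auto simp: nat_pow_def padic_int_group_def\<close>)
  \<comment> \<open>The gcd is a power of p; an exponent above \<open>n\<close> would put
    \<open>x\<close> into p^(n+1) Z_p. Hence \<open>a * x \<equiv> y\<close> modulo p^N is solvable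
    for every \<open>y\<close> in p^n Z_p.\<close>
  have gcd: "gcd (x N) (int p ^ N) dvd int p ^ n"
  proof -
    have "gcd (x N) (int p ^ N) dvd int p ^ N" by simp
    then obtain l where l: "gcd (x N) (int p ^ N) = int p ^ l" "l \<le> N"
      using divides_primepow_weak[of "int p" "gcd (x N) (int p ^ N)" N] p by auto
    have "l \<le> n"
    proof (rule ccontr)
      assume "\<not> l \<le> n"
      then have "Suc n \<le> l" by simp
      then have "int p ^ Suc n dvd gcd (x N) (int p ^ N)" "Suc n \<le> N"
        using l le_imp_power_dvd[of "Suc n" l "int p"] by auto
      then have "int p ^ Suc n dvd x N" by (meson dvd_trans gcd_dvd1)
      then have "x (Suc n) = 0"
        using padic_int_mod[OF xp \<open>Suc n \<le> N\<close>] by (simp add: dvd_eq_mod_eq_0)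
      with x xp show False by (simp add: padic_ideal_def)
    qed
    with l show ?thesis by (simp add: le_imp_power_dvd)
  qed
  have "y \<in> S" if y: "y \<in> padic_ideal p n" for y
  proof -
    have yp: "y \<in> padic_int_set p" using y by (simp add: padic_ideal_def)
    have "y N mod int p ^ n = 0"
      using padic_int_mod[OF yp bd[OF n]] y by (simp add: padic_ideal_def)
    then have "gcd (x N) (int p ^ N) dvd y N"
      using gcd by (auto intro: dvd_trans)
    then obtain b where b: "[x N * b = y N] (mod int p ^ N)"
      using cong_solve_dvd_int by blast
    \<comment> \<open>Reduction modulo p^N makes the multiplier a natural number, so that
      \<open>a\<close> times \<open>x\<close> is reached by addition alone.\<close>
    define a where "a = nat (b mod int p ^ N)"
    have a: "[int a * x N = y N] (mod int p ^ N)"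
    proof -
      have "int a = b mod int p ^ N" using p1 by (simp add: a_def)
      then have "[int a * x N = b * x N] (mod int p ^ N)"
        by (simp add: cong_def mod_mult_left_eq)
      with b show ?thesis by (simp add: mult.commute cong_trans)
    qed
    \<comment> \<open>The remainder \<open>y - a x\<close> lies in p^N Z_p, hence in
      \<open>S\<close>, and \<open>y\<close> is the sum of two elements of \<open>S\<close>.\<close>
    define z where "z = (\<lambda>i. (y i - int a * x i) mod int p ^ i)"
    have mm: "(w mod (int p * int p ^ i)) mod int p ^ i = w mod int p ^ i" for w i
      by (simp add: mod_mod_cancel)
    have "(y (Suc i) - int a * x (Suc i)) mod int p ^ i = (y i - int a * x i) mod int p ^ i" for i
    proof (rule mod_diff_cong)
      show "y (Suc i) mod int p ^ i = y i mod int p ^ i"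
        using padic_int_mod[OF yp, of i "Suc i"] padic_int_mod[OF yp, of i i] by simp
      show "int a * x (Suc i) mod int p ^ i = int a * x i mod int p ^ i"
        using padic_int_mod[OF xp, of i "Suc i"] padic_int_mod[OF xp, of i i]
        by (intro mod_mult_cong) auto
    qed
    then have "z \<in> padic_int_set p"
      using p1 by (simp add: padic_int_set_def z_def mm)
    moreover have "z N = 0"
      using cong_sym[OF a] by (simp add: z_def cong_iff_dvd_diff)
    ultimately have "z \<in> S" using N by (auto simp: padic_ideal_def)
    moreover have "x [^]\<^bsub>padic_int_group p\<^esub> a \<otimes>\<^bsub>padic_int_group p\<^esub> z = y"
    proof
      fix i
      have "(x [^]\<^bsub>padic_int_group p\<^esub> a \<otimes>\<^bsub>padic_int_group p\<^esub> z) i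
        = (int a * x i mod int p ^ i + z i) mod int p ^ i"
        using padic_pow_nth[OF xp, of a i] by (simp add: padic_int_group_def)
      also have "\<dots> = (int a * x i + (y i - int a * x i)) mod int p ^ i"
        unfolding z_def by (rule mod_add_eq)
      also have "\<dots> = y i" using padic_int_mod[OF yp, of i i] by simp
      finally show "(x [^]\<^bsub>padic_int_group p\<^esub> a \<otimes>\<^bsub>padic_int_group p\<^esub> z) i = y i" .
    qed
    ultimately show ?thesis using closed[OF pow[of a]] by metis
  qed
  with n have "S = padic_ideal p n" by blast
  then show ?thesis by blast
qed

text \<open>The element p^a decides: its multiple p^(a+1) lies in p^c Z_p only if
  \<open>c \<le> a + 1\<close>.\<close>

lemma padic_ideal_pow_subset:
  assumes p: "prime p"
    and pow: "\<And>x. x \<in> padic_ideal p a \<Longrightarrow> x [^]\<^bsub>padic_int_group p\<^esub> p \<in> padic_ideal p c"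
  shows "c \<le> Suc a"
proof -
  have p1: "p > 1" using p by (rule prime_gt_1_nat)
  let ?x = "padic_of_nat p (p ^ a)"
  have "?x \<in> padic_ideal p a" using padic_of_prime_power_in_ideal_iff[OF p1] by simp
  from pow[OF this] have "(?x [^]\<^bsub>padic_int_group p\<^esub> p) c = 0"
    by (simp add: padic_ideal_def)
  then have "padic_of_nat p (p ^ Suc a) c = 0"
    using padic_of_nat_in[of p "p ^ a"] p1
    by (simp add: padic_pow_nth) (simp add: padic_of_nat_def mod_mult_right_eq)
  then have "padic_of_nat p (p ^ Suc a) \<in> padic_ideal p c"
    using padic_of_nat_in[of p "p ^ Suc a"] p1 by (simp add: padic_ideal_def)
  then show ?thesis
    using padic_of_prime_power_in_ideal_iff[OF p1] by blast
qed

section \<open>Small polydiscs in an analytic Lie group\<close>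

lemma sum_lessThan_add:
  fixes f :: "nat \<Rightarrow> 'a::comm_monoid_add"
  shows "(\<Sum>i<m + n. f i) = (\<Sum>i<m. f i) + (\<Sum>i<n. f (m + i))"
  by (induction n) (simp_all add: add.assoc)

lemma is_chartD:
  assumes "is_chart T m (U, \<phi>)"
  shows "openin T U" "openin (K_space m) (\<phi> ` U)" "inj_on \<phi> U"
    "\<And>x. x \<in> U \<Longrightarrow> \<phi> x \<in> topspace (K_space m)"
    "\<And>W. openin (K_space m) W \<Longrightarrow> openin T {x \<in> U. \<phi> x \<in> W}"
proof -
  have chart: "openin T U" "openin (K_space m) (\<phi> ` U)"
    "homeomorphic_map (subtopology T U) (subtopology (K_space m) (\<phi> ` U)) \<phi>"
    using assms by (auto simp: is_chart_def)
  then show "openin T U" "openin (K_space m) (\<phi> ` U)" by blast+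
  have top: "topspace (subtopology T U) = U"
    using openin_subset[OF chart(1)] by auto
  then show "inj_on \<phi> U"
    using homeomorphic_imp_injective_map[OF chart(3)] by simp
  show "\<phi> x \<in> topspace (K_space m)" if "x \<in> U" for x
    using openin_subset[OF chart(2)] that by blast
  have "continuous_map (subtopology T U) (K_space m) \<phi>"
    using homeomorphic_imp_continuous_map[OF chart(3)] by (simp add: continuous_map_in_subtopology)
  then show "openin T {x \<in> U. \<phi> x \<in> W}" if "openin (K_space m) W" for W
    using openin_continuous_map_preimage[OF _ that, of "subtopology T U" \<phi>]
      openin_trans_full[OF _ chart(1)] unfolding top by blast
qed

text \<open>Injectivity is needed to evaluate \<open>inv_into\<close> in the coordinate form of
  multiplication. Coordinates \<open>i\<close> and \<open>m + i\<close> recover the two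
  factors.\<close>

lemma inj_on_prod_chart:
  assumes "inj_on \<phi> U" "\<And>x. x \<in> U \<Longrightarrow> \<phi> x \<in> topspace (K_space m)"
  shows "inj_on (snd (prod_chart m m (U, \<phi>) (U, \<phi>))) (U \<times> U)"
proof (rule inj_onI)
  fix z z' assume "z \<in> U \<times> U" "z' \<in> U \<times> U"
  then obtain x y x' y' where z: "z = (x, y)" "z' = (x', y')" "x \<in> U" "y \<in> U" "x' \<in> U" "y' \<in> U"
    by blast
  assume "snd (prod_chart m m (U, \<phi>) (U, \<phi>)) z = snd (prod_chart m m (U, \<phi>) (U, \<phi>)) z'"
  then have eq: "(\<lambda>i\<in>{..<m + m}. if i < m then \<phi> x i else \<phi> y (i - m)) =
      (\<lambda>i\<in>{..<m + m}. if i < m then \<phi> x' i else \<phi> y' (i - m))"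
    by (simp only: prod_chart_def z fst_conv snd_conv prod.case)
  have "\<phi> x i = \<phi> x' i" "\<phi> y i = \<phi> y' i" if "i < m" for i
    using fun_cong[OF eq, of i] fun_cong[OF eq, of "m + i"] that by simp_all
  moreover have "\<phi> w \<in> extensional {..<m}" if "w \<in> U" for w
    using assms(2)[OF that] by (simp add: K_space_def PiE_iff)
  ultimately have "\<phi> x = \<phi> x'" "\<phi> y = \<phi> y'"
    using z by (auto intro!: extensionalityI[where A = "{..<m}"])
  with assms(1) z show "z = z'" by (auto dest: inj_onD)
qed

text \<open>Polydiscs are centred at the image of \<open>e\<close>, so the chart need not send the
  unit to 0.\<close>

definition chart_ball :: "nat \<Rightarrow> ('g, 'a::field) chart \<Rightarrow> 'g \<Rightarrow> int \<Rightarrow> 'g set" where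
  "chart_ball m c e k = {x \<in> fst c. snd c x \<in> polydisc m (snd c e) k}"

text \<open>Multiplication in coordinates is expanded to first order at the pair of units. Its
  linear part splits into one summand per factor, and the unit laws force each to be the identity up
  to the same quadratic error.\<close>

lemma K_lie_group_mult_approximation:
  fixes A :: "('g, 'a::field) chart set" and G (structure)
  assumes lie: "K_lie_group G T m A" and c: "(U, \<phi>) \<in> A" and e: "\<one> \<in> U"
  shows "\<exists>r N. \<forall>k\<ge>r. \<forall>x\<in>chart_ball m (U, \<phi>) \<one> k. \<forall>y\<in>chart_ball m (U, \<phi>) \<one> k.
    x \<otimes> y \<in> U \<and> (\<forall>j<m. (\<phi> (x \<otimes> y) j - \<phi> \<one> j) - (\<phi> x j - \<phi> \<one> j) - (\<phi> y j - \<phi> \<one> j)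
      \<in> fls_ideal (2 * k - N))"
proof -
  interpret group G using lie by (simp add: K_lie_group_def)
  have chart: "is_chart T m (U, \<phi>)"
    using lie c by (auto simp: K_lie_group_def K_atlas_def)
  have UG: "U \<subseteq> carrier G"
    using openin_subset[OF is_chartD(1)[OF chart]] lie by (auto simp: K_lie_group_def)
  define \<Phi> where "\<Phi> = snd (prod_chart m m (U, \<phi>) (U, \<phi>))"
  define W where "W = \<Phi> ` {z \<in> U \<times> U. (\<lambda>(x, y). x \<otimes> y) z \<in> U}"
  define F where "F = \<phi> \<circ> (\<lambda>(x, y). x \<otimes> y) \<circ> inv_into (U \<times> U) \<Phi>"
  have inj: "inj_on \<Phi> (U \<times> U)"
    unfolding \<Phi>_def using is_chartD[OF chart] by (intro inj_on_prod_chart) auto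
  have \<Phi>: "\<Phi> (x, y) = (\<lambda>i\<in>{..<m + m}. if i < m then \<phi> x i else \<phi> y (i - m))" for x y
    by (simp only: \<Phi>_def prod_chart_def fst_conv snd_conv prod.case)
  have "prod_chart m m (U, \<phi>) (U, \<phi>) \<in> prod_atlas m m A A"
    using c by (auto simp: prod_atlas_def)
  moreover have "prod_chart m m (U, \<phi>) (U, \<phi>) = (U \<times> U, \<Phi>)"
    by (simp add: \<Phi>_def prod_chart_def)
  ultimately have "K_analytic_on (m + m) m W F"
    using lie c unfolding K_lie_group_def K_analytic_map_def W_def F_def by fastforce
  moreover have "\<Phi> (\<one>, \<one>) \<in> W"
    using e by (auto simp: W_def)
  ultimately obtain r N L where W: "polydisc (m + m) (\<Phi> (\<one>, \<one>)) r \<subseteq> W"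
    and approx: "\<And>k z j. r \<le> k \<Longrightarrow> z \<in> polydisc (m + m) (\<Phi> (\<one>, \<one>)) k \<Longrightarrow> j < m \<Longrightarrow>
      F z j - F (\<Phi> (\<one>, \<one>)) j - (\<Sum>i<m + m. L j i * (z i - \<Phi> (\<one>, \<one>) i)) \<in> fls_ideal (2 * k - N)"
    using K_analytic_on_linear_approximation[of "m + m" m W F "\<Phi> (\<one>, \<one>)"] by blast
  have F: "F (\<Phi> (x, y)) = \<phi> (x \<otimes> y)" if "x \<in> U" "y \<in> U" for x y
    using inj that by (simp add: F_def)
  have poly: "\<Phi> (x, y) \<in> polydisc (m + m) (\<Phi> (\<one>, \<one>)) k"
    if "x \<in> chart_ball m (U, \<phi>) \<one> k" "y \<in> chart_ball m (U, \<phi>) \<one> k" for x y k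
    using that by (auto simp: chart_ball_def polydisc_iff \<Phi> K_space_def)
  \<comment> \<open>A point of \<open>W\<close> is the image of a pair with product in
    \<open>U\<close>; injectivity shows that this pair is \<open>(x, y)\<close>.\<close>
  have in_U: "x \<otimes> y \<in> U"
    if "r \<le> k" "x \<in> chart_ball m (U, \<phi>) \<one> k" "y \<in> chart_ball m (U, \<phi>) \<one> k" for x y k
  proof -
    have "\<Phi> (x, y) \<in> W"
      using poly[OF that(2,3)] polydisc_mono[OF that(1)] W by blast
    then obtain z where z: "z \<in> U \<times> U" "(\<lambda>(x, y). x \<otimes> y) z \<in> U" "\<Phi> (x, y) = \<Phi> z"
      by (auto simp: W_def)
    have "(x, y) \<in> U \<times> U" using that by (auto simp: chart_ball_def)
    then have "z = (x, y)" using inj_onD[OF inj z(3)] z(1) by simp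
    with z(2) show ?thesis by simp
  qed
  define l1 where "l1 = (\<lambda>j x. \<Sum>i<m. L j i * (\<phi> x i - \<phi> \<one> i))"
  define l2 where "l2 = (\<lambda>j x. \<Sum>i<m. L j (m + i) * (\<phi> x i - \<phi> \<one> i))"
  have split: "\<phi> (x \<otimes> y) j - \<phi> \<one> j - (l1 j x + l2 j y) \<in> fls_ideal (2 * k - N)"
    if "r \<le> k" "x \<in> chart_ball m (U, \<phi>) \<one> k" "y \<in> chart_ball m (U, \<phi>) \<one> k" "j < m" for x y k j
  proof -
    have U: "x \<in> U" "y \<in> U" using that by (auto simp: chart_ball_def)
    have "(\<Sum>i<m + m. L j i * (\<Phi> (x, y) i - \<Phi> (\<one>, \<one>) i)) = l1 j x + l2 j y"
      by (simp add: sum_lessThan_add \<Phi> l1_def l2_def)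
    with approx[OF that(1) poly[OF that(2,3)] that(4)] F[OF U] F[OF e e] show ?thesis by simp
  qed
  have e_ball: "\<one> \<in> chart_ball m (U, \<phi>) \<one> k" for k
    using e is_chartD(4)[OF chart] by (simp add: chart_ball_def polydisc_iff)
  have zero: "l1 j \<one> = 0" "l2 j \<one> = 0" for j
    by (simp_all add: l1_def l2_def)
  have "(\<phi> (x \<otimes> y) j - \<phi> \<one> j) - (\<phi> x j - \<phi> \<one> j) - (\<phi> y j - \<phi> \<one> j) \<in> fls_ideal (2 * k - N)"
    if k: "r \<le> k" and x: "x \<in> chart_ball m (U, \<phi>) \<one> k" and y: "y \<in> chart_ball m (U, \<phi>) \<one> k"
      and j: "j < m" for x y k j
  proof -
    have "x \<in> carrier G" "y \<in> carrier G" using x y UG by (auto simp: chart_ball_def)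
    \<comment> \<open>multiplication by the unit identifies both partial derivatives as the identity\<close>
    then have "\<phi> x j - \<phi> \<one> j - l1 j x \<in> fls_ideal (2 * k - N)"
      "\<phi> y j - \<phi> \<one> j - l2 j y \<in> fls_ideal (2 * k - N)"
      using split[OF k x e_ball j] split[OF k e_ball y j] zero by simp_all
    from fls_ideal_diff[OF fls_ideal_diff[OF split[OF k x y j] this(1)] this(2)]
    show ?thesis by (simp add: algebra_simps)
  qed
  with in_U show ?thesis by blast
qed

text \<open>Once \<open>2 * k - N \<ge> k + 2\<close>, multiplication on the ball of index
  \<open>k\<close> is addition of coordinates modulo X^(k+2). The balls are then submonoids, and the
  n-th power is multiplication by n modulo X^(k+2), which vanishes for n the characteristic.\<close>

lemma K_lie_group_filtration:
  fixes A :: "('g, 'a::field) chart set" and G (structure)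
  assumes lie: "K_lie_group G T m A"
  shows "\<exists>V :: nat \<Rightarrow> 'g set. (\<forall>n. openin T (V n) \<and> \<one> \<in> V n \<and> V (Suc n) \<subseteq> V n
    \<and> (\<forall>x\<in>V n. \<forall>y\<in>V n. x \<otimes> y \<in> V n)
    \<and> (m > 0 \<longrightarrow> V (Suc n) \<noteq> V n) \<and> (m = 0 \<longrightarrow> V n = {\<one>})
    \<and> (\<forall>x\<in>V n. x [^] CHAR('a) \<in> V (n + 2)))"
proof -
  interpret group G using lie by (simp add: K_lie_group_def)
  have "\<one> \<in> (\<Union>c\<in>A. fst c)"
    using lie by (simp add: K_lie_group_def K_atlas_def)
  then obtain U \<phi> where c: "(U, \<phi>) \<in> A" and e: "\<one> \<in> U" by auto
  have chart: "is_chart T m (U, \<phi>)"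
    using lie c by (auto simp: K_lie_group_def K_atlas_def)
  have UG: "U \<subseteq> carrier G"
    using openin_subset[OF is_chartD(1)[OF chart]] lie by (auto simp: K_lie_group_def)
  let ?B = "chart_ball m (U, \<phi>) \<one>"
  let ?u = "\<lambda>x j. \<phi> x j - \<phi> \<one> j"
  obtain r N where mult: "\<And>k x y. r \<le> k \<Longrightarrow> x \<in> ?B k \<Longrightarrow> y \<in> ?B k \<Longrightarrow> x \<otimes> y \<in> U \<and>
      (\<forall>j<m. ?u (x \<otimes> y) j - ?u x j - ?u y j \<in> fls_ideal (2 * k - N))"
    using K_lie_group_mult_approximation[OF lie c e] by blast
  obtain r' where r': "polydisc m (\<phi> \<one>) r' \<subseteq> \<phi> ` U"
    using openin_K_space_contains_polydisc[OF is_chartD(2)[OF chart], of "\<phi> \<one>"] e by blast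
  \<comment> \<open>\<open>r\<close> validates the product estimate, \<open>r'\<close> keeps
    polydiscs inside the chart image, and \<open>N + 2\<close> turns the quadratic error into a gain
    of two levels.\<close>
  define K where "K = max (max r r') (N + 2)"
  have ball_iff: "x \<in> ?B k \<longleftrightarrow> x \<in> U \<and> (\<forall>j<m. ?u x j \<in> fls_ideal k)" for x k
    using is_chartD(4)[OF chart] by (auto simp: chart_ball_def polydisc_iff)
  have approx: "?u (x \<otimes> y) j - ?u x j - ?u y j \<in> fls_ideal (k + 2)"
    if "K \<le> k" "x \<in> ?B k" "y \<in> ?B k" "j < m" for x y j k
  proof -
    have "?u (x \<otimes> y) j - ?u x j - ?u y j \<in> fls_ideal (2 * k - N)"
      using mult[of k x y] that by (simp add: K_def)
    then show ?thesis by (rule fls_ideal_mono) (use that(1) in \<open>simp add: K_def\<close>)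
  qed
  have closed: "x \<otimes> y \<in> ?B k" if k: "K \<le> k" and x: "x \<in> ?B k" and y: "y \<in> ?B k" for x y k
  proof -
    have "?u (x \<otimes> y) j \<in> fls_ideal k" if j: "j < m" for j
    proof -
      have "?u (x \<otimes> y) j - ?u x j - ?u y j \<in> fls_ideal k"
        by (rule fls_ideal_mono[OF approx[OF k x y j]]) simp
      moreover have "?u x j \<in> fls_ideal k" "?u y j \<in> fls_ideal k"
        using x y j by (simp_all add: ball_iff)
      ultimately have "(?u (x \<otimes> y) j - ?u x j - ?u y j) + ?u x j + ?u y j \<in> fls_ideal k"
        by (intro fls_ideal_add)
      then show ?thesis by simp
    qed
    moreover have "x \<otimes> y \<in> U" using mult[of k x y] k x y by (simp add: K_def)
    ultimately show ?thesis by (simp add: ball_iff)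
  qed
  have unit: "\<one> \<in> ?B k" for k
    using e by (simp add: ball_iff)
  \<comment> \<open>Membership of the power in the ball is carried along, as the product estimate
    needs it at the next step.\<close>
  have pow: "x [^] n \<in> ?B k \<and> (\<forall>j<m. ?u (x [^] n) j - of_nat n * ?u x j \<in> fls_ideal (k + 2))"
    if k: "K \<le> k" and x: "x \<in> ?B k" for x k and n :: nat
  proof (induction n)
    case 0
    then show ?case using unit by simp
  next
    case (Suc n)
    have "?u (x [^] Suc n) j - of_nat (Suc n) * ?u x j \<in> fls_ideal (k + 2)" if j: "j < m" for j
    proof -
      have "?u (x [^] n \<otimes> x) j - ?u (x [^] n) j - ?u x j \<in> fls_ideal (k + 2)"
        using approx[OF k _ x j] Suc by blast
      moreover have "?u (x [^] n) j - of_nat n * ?u x j \<in> fls_ideal (k + 2)"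
        using Suc j by blast
      ultimately have "(?u (x [^] n \<otimes> x) j - ?u (x [^] n) j - ?u x j) +
          (?u (x [^] n) j - of_nat n * ?u x j) \<in> fls_ideal (k + 2)"
        by (rule fls_ideal_add)
      then show ?thesis by (simp add: algebra_simps)
    qed
    moreover have "x [^] Suc n \<in> ?B k"
      using closed[OF k _ x] Suc by simp
    ultimately show ?case by blast
  qed
  have pow_char: "x [^] CHAR('a) \<in> ?B (k + 2)" if "K \<le> k" "x \<in> ?B k" for x k
  proof -
    have "of_nat CHAR('a) = (0 :: 'a fls)"
      by (simp add: of_nat_eq_0_iff_char_dvd)
    then show ?thesis
      using pow[OF that, of "CHAR('a)"] by (auto simp: ball_iff)
  qed
  have strict: "?B (k + 1) \<noteq> ?B k" if k: "K \<le> k" and m: "m > 0" for k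
  proof -
    \<comment> \<open>A displacement by exactly X^k lies in the ideal of exponent \<open>k\<close>
      but not in that of exponent \<open>k + 1\<close>.\<close>
    define y where "y = (\<lambda>i\<in>{..<m}. \<phi> \<one> i + (fls_X_intpow k :: 'a fls))"
    have "y \<in> polydisc m (\<phi> \<one>) k"
      by (auto simp: y_def polydisc_iff K_space_def fls_ideal_def)
    moreover have "polydisc m (\<phi> \<one>) k \<subseteq> \<phi> ` U"
      using r' polydisc_mono[of r' k m "\<phi> \<one>"] k by (auto simp: K_def)
    ultimately obtain x where x: "x \<in> U" "y = \<phi> x" by blast
    then have "x \<in> ?B k"
      using \<open>y \<in> polydisc m (\<phi> \<one>) k\<close> by (simp add: chart_ball_def)
    moreover have "x \<notin> ?B (k + 1)"
    proof
      assume "x \<in> ?B (k + 1)"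
      then have "?u x 0 \<in> fls_ideal (k + 1)" using m by (simp add: ball_iff)
      moreover have "?u x 0 = fls_X_intpow k"
        using m by (simp add: y_def flip: x(2))
      ultimately show False by (auto simp: fls_ideal_def dest: spec[of _ k])
    qed
    ultimately show ?thesis by blast
  qed
  \<comment> \<open>K^0 is a single point and the chart is injective, so the chart domain is just
    the unit.\<close>
  have trivial: "?B k = {\<one>}" if "m = 0" for k
  proof -
    have "\<phi> x = \<phi> \<one>" if "x \<in> U" for x
      using is_chartD(4)[OF chart that] is_chartD(4)[OF chart e] \<open>m = 0\<close> by (simp add: K_space_def)
    then have "x = \<one>" if "x \<in> U" for x
      using that by (intro inj_onD[OF is_chartD(3)[OF chart] _ that e]) blast
    then have "U = {\<one>}" using e by blast
    then show ?thesis using \<open>m = 0\<close> ball_iff[of _ k] by blast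
  qed
  have opn: "openin T (?B k)" for k
    using is_chartD(5)[OF chart openin_polydisc] by (simp add: chart_ball_def)
  have dec: "?B (k + 1) \<subseteq> ?B k" for k
    using polydisc_mono[of k "k + 1" m "\<phi> \<one>"] by (auto simp: chart_ball_def)
  show ?thesis
  proof (intro exI[of _ "\<lambda>n. ?B (K + int n)"] allI conjI ballI impI)
    fix n
    show "?B (K + int (Suc n)) \<subseteq> ?B (K + int n)"
      using dec[of "K + int n"] by (simp add: algebra_simps)
    show "?B (K + int (Suc n)) \<noteq> ?B (K + int n)" if "m > 0"
      using strict[of "K + int n"] that by (simp add: algebra_simps)
    show "x [^] CHAR('a) \<in> ?B (K + int (n + 2))" if "x \<in> ?B (K + int n)" for x
      using pow_char[OF _ that] by (simp add: algebra_simps)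
  qed (use opn unit closed trivial in auto)
qed

section \<open>Transfer to Z_p and the contradiction\<close>

text \<open>The image of the unit is idempotent: each coordinate \<open>c\<close> satisfies
  \<open>2 c \<equiv> c\<close> modulo p^n, and the range of representatives leaves only 0.\<close>

lemma hom_padic_one:
  assumes "f \<in> hom H (padic_int_group p)" "group H"
  shows "f \<one>\<^bsub>H\<^esub> = (\<lambda>_. 0)"
proof
  fix n
  interpret group H by fact
  have "f \<one>\<^bsub>H\<^esub> \<in> padic_int_set p"
    using hom_in_carrier[OF assms(1), of "\<one>\<^bsub>H\<^esub>"] by (simp add: padic_int_group_def)
  then have x: "0 \<le> f \<one>\<^bsub>H\<^esub> n" "f \<one>\<^bsub>H\<^esub> n < int p ^ n"
    by (auto simp: padic_int_set_def)
  have "f \<one>\<^bsub>H\<^esub> = f \<one>\<^bsub>H\<^esub> \<otimes>\<^bsub>padic_int_group p\<^esub> f \<one>\<^bsub>H\<^esub>"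
    using hom_mult[OF assms(1), of "\<one>\<^bsub>H\<^esub>" "\<one>\<^bsub>H\<^esub>"] by simp
  then have "(f \<one>\<^bsub>H\<^esub> n + f \<one>\<^bsub>H\<^esub> n) mod int p ^ n = f \<one>\<^bsub>H\<^esub> n"
    by (metis (no_types, lifting) monoid.simps(1) padic_int_group_def)
  then have "(f \<one>\<^bsub>H\<^esub> n + f \<one>\<^bsub>H\<^esub> n) mod int p ^ n = f \<one>\<^bsub>H\<^esub> n mod int p ^ n"
    using x by simp
  then have "int p ^ n dvd f \<one>\<^bsub>H\<^esub> n"
    by (simp add: mod_eq_dvd_iff)
  with x show "f \<one>\<^bsub>H\<^esub> n = 0"
    using zdvd_imp_le[of "int p ^ n" "f \<one>\<^bsub>H\<^esub> n"] by linarith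
qed

lemma hom_padic_pow:
  assumes "f \<in> hom H (padic_int_group p)" "group H" "x \<in> carrier H"
  shows "f (x [^]\<^bsub>H\<^esub> (n::nat)) = f x [^]\<^bsub>padic_int_group p\<^esub> n"
proof -
  interpret group H by fact
  have "f x [^]\<^bsub>padic_int_group p\<^esub> Suc k = f x [^]\<^bsub>padic_int_group p\<^esub> k \<otimes>\<^bsub>padic_int_group p\<^esub> f x" for k
    by (simp add: nat_pow_def)
  moreover have "f x [^]\<^bsub>padic_int_group p\<^esub> (0::nat) = (\<lambda>_. 0)"
    by (simp add: nat_pow_def padic_int_group_def)
  ultimately show ?thesis
    using assms(3) by (induction n) (simp_all add: hom_padic_one[OF assms(1,2)] hom_mult[OF assms(1)])
qed

text \<open>The isomorphism carries \<open>V n\<close> to p^(a n) Z_p. For \<open>m > 0\<close>, two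
  strict inclusions give \<open>a 2 \<ge> a 0 + 2\<close>, whereas the p-th power map gives
  \<open>a 2 \<le> a 0 + 1\<close>.\<close>

lemma padic_not_K_lie_group:
  fixes A :: "('g, 'a::{field, finite}) chart set"
  assumes p: "CHAR('a) = p"
    and iso: "topological_group_isomorphic H T (padic_int_group p) (padic_int_topology p)"
  shows "\<not> K_lie_group H T m A"
proof
  assume lie: "K_lie_group H T m A"
  interpret group H using lie by (simp add: K_lie_group_def)
  have T: "topspace T = carrier H" using lie by (simp add: K_lie_group_def)
  have prime: "prime p"
    using prime_CHAR_semidom[where ?'a = 'a] finite_imp_CHAR_pos[where ?'a = 'a] p by simp
  then have p1: "p > 1" by (rule prime_gt_1_nat)
  obtain f where f: "f \<in> iso H (padic_int_group p)" "homeomorphic_map T (padic_int_topology p) f"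
    using iso unfolding topological_group_isomorphic_def by blast
  have hom: "f \<in> hom H (padic_int_group p)" and inj: "inj_on f (carrier H)"
    using f(1) by (auto simp: iso_def bij_betw_def)
  obtain V where filtration: "\<forall>n. openin T (V n) \<and> \<one>\<^bsub>H\<^esub> \<in> V n \<and> V (Suc n) \<subseteq> V n
    \<and> (\<forall>x\<in>V n. \<forall>y\<in>V n. x \<otimes>\<^bsub>H\<^esub> y \<in> V n)
    \<and> (m > 0 \<longrightarrow> V (Suc n) \<noteq> V n) \<and> (m = 0 \<longrightarrow> V n = {\<one>\<^bsub>H\<^esub>})
    \<and> (\<forall>x\<in>V n. x [^]\<^bsub>H\<^esub> p \<in> V (n + 2))"
    using K_lie_group_filtration[OF lie] unfolding p by (rule exE)
  then have V: "\<And>n. openin T (V n)" "\<And>n. \<one>\<^bsub>H\<^esub> \<in> V n" "\<And>n. V (Suc n) \<subseteq> V n"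
    "\<And>n x y. x \<in> V n \<Longrightarrow> y \<in> V n \<Longrightarrow> x \<otimes>\<^bsub>H\<^esub> y \<in> V n"
    "\<And>n. m > 0 \<Longrightarrow> V (Suc n) \<noteq> V n" "\<And>n. m = 0 \<Longrightarrow> V n = {\<one>\<^bsub>H\<^esub>}"
    "\<And>n x. x \<in> V n \<Longrightarrow> x [^]\<^bsub>H\<^esub> p \<in> V (n + 2)"
    by blast+
  have VH: "V n \<subseteq> carrier H" for n
    using openin_subset[OF V(1)] T by blast
  have "\<exists>a. f ` V n = padic_ideal p a" for n
  proof (rule open_padic_submonoid[OF prime])
    show "openin (padic_int_topology p) (f ` V n)"
      using homeomorphic_map_openness_eq[OF f(2)] V(1) by blast
    show "(\<lambda>_. 0) \<in> f ` V n"
      using V(2) hom_padic_one[OF hom is_group] by (metis imageI)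
    fix x y assume "x \<in> f ` V n" "y \<in> f ` V n"
    then obtain x' y' where "x' \<in> V n" "y' \<in> V n" "x = f x'" "y = f y'" by blast
    moreover from this have "f (x' \<otimes>\<^bsub>H\<^esub> y') = f x' \<otimes>\<^bsub>padic_int_group p\<^esub> f y'"
      using VH by (intro hom_mult[OF hom]) blast+
    ultimately show "x \<otimes>\<^bsub>padic_int_group p\<^esub> y \<in> f ` V n"
      using V(4) by (metis imageI)
  qed
  then have "\<exists>a. \<forall>n. f ` V n = padic_ideal p (a n)"
    by (intro choice allI)
  then obtain a where a: "\<And>n. f ` V n = padic_ideal p (a n)" by blast
  show False
  proof (cases "m = 0")
    case True
    \<comment> \<open>A trivial ideal p^(a 0) Z_p would force its element p^(a 0) to be 0, hence to
      lie in the next ideal as well.\<close>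
    then have "padic_ideal p (a 0) = {\<lambda>_. 0}"
      using a[of 0] V(6) hom_padic_one[OF hom is_group] by simp
    moreover have "(\<lambda>_. 0) \<in> padic_ideal p (Suc (a 0))"
      using p1 by (simp add: padic_ideal_def padic_int_set_def)
    ultimately have "Suc (a 0) \<le> a 0"
      using padic_of_prime_power_in_ideal_iff[OF p1, of "a 0"] by (metis order_refl singletonD)
    then show False by simp
  next
    case False
    have less: "a n < a (Suc n)" for n
    proof -
      have "padic_ideal p (a (Suc n)) \<subseteq> padic_ideal p (a n)"
        using V(3) by (metis a image_mono)
      then have "a n \<le> a (Suc n)" by (rule padic_ideal_subset_imp_le[OF p1])
      moreover have "a n \<noteq> a (Suc n)"
      proof
        assume "a n = a (Suc n)"
        then have "f ` V n = f ` V (Suc n)" by (simp add: a)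
        then have "V n = V (Suc n)" using inj VH by (simp add: inj_on_image_eq_iff)
        with V(5) False show False by auto
      qed
      ultimately show ?thesis by simp
    qed
    have "x [^]\<^bsub>padic_int_group p\<^esub> p \<in> padic_ideal p (a 2)" if "x \<in> padic_ideal p (a 0)" for x
    proof -
      obtain y where y: "y \<in> V 0" "x = f y" using \<open>x \<in> padic_ideal p (a 0)\<close> a by blast
      then have "f (y [^]\<^bsub>H\<^esub> p) \<in> f ` V 2" using V(7)[of y 0] by (simp add: numeral_2_eq_2)
      then show ?thesis
        using hom_padic_pow[OF hom is_group subsetD[OF VH y(1)], of p] y(2) a by simp
    qed
    then have "a 2 \<le> Suc (a 0)" by (rule padic_ideal_pow_subset[OF prime])
    with less[of 0] less[of 1] show False by (simp add: numeral_2_eq_2)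
  qed
qed

theorem theorem1p2:
  fixes p :: nat
    and G :: "('g, 'b) monoid_scheme"
    and T :: "'g topology"
    and d :: nat
    and A :: "('g, 'a::{field, finite}) chart set"
    and H :: "'g set"
  assumes "CHAR('a) = p"
    and "K_lie_group G T d A"
    and "subgroup H G"
    and "compactin T H"
    and "topological_group_isomorphic (G\<lparr>carrier := H\<rparr>) (subtopology T H)
           (padic_int_group p) (padic_int_topology p)"
  shows "\<not> (\<exists>m (B :: ('g, 'a) chart set).
           K_lie_group (G\<lparr>carrier := H\<rparr>) (subtopology T H) m B)"
  using padic_not_K_lie_group[OF assms(1,5)] by blast

end
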